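(* Let $d\ge2$, $1<p<\infty$ and $p'=p/(p-1)$. Then $$\sup\{F_{p,1}(A,h) : \mathcal{H}^{d-1}(A)<+\infty,\ h\ge0\}=\gamma_p,$$ $$\inf\{F_{p,1}(A,h) : A\text{ convex and bounded},\ h\ge0,\ h\text{ concave}\}=\gamma_p\,d^{\,p-1}\binom{d+p'}{d-1}^{1-p}.$$ In addition, the first equality (the supremum) is attained by taking $h$ to be any (positive) constant function, while the second equality (the infimum) is attained by taking as $A$ the unit ball of $\mathbb{R}^{d-1}$ and $h(x)=1-|x|$.
   Context: Here $A\subset\mathbb{R}^{d-1}$ is a nonempty open set, $\mathcal{H}^{d-1}$ is the $(d-1)$-dimensional Hausdorff (i.e. Lebesgue) measure, and $h:A\to[0,\infty)$ is a bounded measurable function, not almost everywhere zero (the local thickness function). The functional is $$F_{p,1}(A,h)=\gamma_p\left(\frac{\int_A h^{p'+1}\,dx}{\|h\|_{\infty}^{p'}\int_A h\,dx}\right)^{p-1},\qquad \gamma_p=\Big(\frac{\pi_p}{2}\Big)^p\Big(\frac{1}{p'+1}\Big)^{p-1},\qquad \pi_p=2\pi\frac{(p-1)^{1/p}}{p\sin(\pi/p)},$$ with $\|h\|_\infty$ the $L^\infty(A)$ norm. The binomial coefficient with real upper entry is $\binom{a}{k}=\frac{\Gamma(a+1)}{\Gamma(k+1)\Gamma(a-k+1)}$. *)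

theory Defs
  imports "HOL-Analysis.Analysis" "HOL-Probability.Essential_Supremum"
begin

definition conj_exp :: "real \<Rightarrow> real" where
  "conj_exp p = p / (p - 1)"

definition pi_p :: "real \<Rightarrow> real" where
  "pi_p p = 2 * pi * ((p - 1) powr (1 / p) / (p * sin (pi / p)))"

definition gamma_p :: "real \<Rightarrow> real" where
  "gamma_p p = (pi_p p / 2) powr p * (1 / (conj_exp p + 1)) powr (p - 1)"

definition real_binomial :: "real \<Rightarrow> nat \<Rightarrow> real" where
  "real_binomial a k = Gamma (a + 1) / (Gamma (real k + 1) * Gamma (a - real k + 1))"

lemma real_binomial_eq_gchoose:
  assumes "a + 1 \<notin> \<int>\<^sub>\<le>\<^sub>0"
  shows "real_binomial a k = a gchoose k"
  using gbinomial_Gamma[OF assms, of k] Gamma_fact[of k, where 'a = real]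
  by (simp add: real_binomial_def add.commute)

(* The essential supremum is taken in ereal, the library's esssup requiring a complete
   order; it is finite for the essentially bounded functions to which the norm is applied. *)
definition Linf_norm :: "'a::euclidean_space set \<Rightarrow> ('a \<Rightarrow> real) \<Rightarrow> real" where
  "Linf_norm A h = real_of_ereal (esssup (lebesgue_on A) (\<lambda>x. ereal \<bar>h x\<bar>))"

definition F_p1 :: "real \<Rightarrow> 'a::euclidean_space set \<Rightarrow> ('a \<Rightarrow> real) \<Rightarrow> real" where
  "F_p1 p A h =
     gamma_p p *
       (integral\<^sup>L (lebesgue_on A) (\<lambda>x. h x powr (conj_exp p + 1)) /
        (Linf_norm A h powr conj_exp p * integral\<^sup>L (lebesgue_on A) h)) powr (p - 1)"

(* A function on A is represented by a total function; its values outside A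
   are unconstrained and enter none of the definitions. *)
definition admissible :: "'a::euclidean_space set \<Rightarrow> ('a \<Rightarrow> real) \<Rightarrow> bool" where
  "admissible A h \<longleftrightarrow>
     open A \<and> A \<noteq> {} \<and>
     h \<in> borel_measurable (lebesgue_on A) \<and> bounded (h ` A) \<and>
     (\<forall>x\<in>A. 0 \<le> h x) \<and> \<not> (AE x in lebesgue_on A. h x = 0)"

definition sup_class :: "('a::euclidean_space set \<times> ('a \<Rightarrow> real)) set" where
  "sup_class = {(A, h). admissible A h \<and> emeasure lebesgue A < \<infinity>}"

definition inf_class :: "('a::euclidean_space set \<times> ('a \<Rightarrow> real)) set" where
  "inf_class = {(A, h). admissible A h \<and> convex A \<and> bounded A \<and> concave_on A h}"

end

theory Submission
  imports Defs
begin

text \<open>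
  The upper bound is $h^{p'+1} \le \|h\|_\infty^{p'} h$. For the lower bound, normalise
  $k = h / \|h\|_\infty$ and let $V(t)$ be the measure of the set $k > t$. Contracting this set toward
  a point at which $k$ is almost maximal shows, by concavity alone, that
  $V(t) / (1 - t)^N$ is nondecreasing on $[0, 1)$, where $N = d - 1$; it is constant for the cone
  $1 - |x|$. By the layer cake formula, $\int k^a - c \int k = \int_0^1 (a t^{a-1} - c) V(t)\, dt$.
  The weight $a t^{a-1} - c$ changes sign once, from negative to positive, so if $c$ is the constant
  that makes the integral vanish for $V(t) = (1 - t)^N$ (a quotient of Beta integrals), then it is
  nonnegative for every $V$ arising from a concave $k$.
\<close>

section \<open>Layer cake formula and single crossing\<close>

text \<open>Fubini for \<open>\<phi> t\<close> times the indicator of \<open>t < h x\<close>: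
  integrating over \<open>t\<close> first gives \<open>\<Phi> (h x)\<close> by the fundamental
  theorem of calculus, integrating over \<open>x\<close> first gives the superlevel measures. The
  derivative is asked for in the open interval only, as powers of \<open>t\<close> are
  differentiated at positive \<open>t\<close>.\<close>

lemma layer_cake_has_integral:
  fixes h :: "'b \<Rightarrow> real" and \<phi> \<Phi> :: "real \<Rightarrow> real"
  assumes "finite_measure M" and [measurable]: "h \<in> borel_measurable M"
    and h: "AE x in M. 0 \<le> h x \<and> h x \<le> 1"
    and cont: "continuous_on {0..1} \<phi>"
    and cont_\<Phi>: "continuous_on {0..1} \<Phi>"
    and deriv: "\<And>t. t \<in> {0<..<1} \<Longrightarrow> (\<Phi> has_real_derivative \<phi> t) (at t)"
    and "\<Phi> 0 = 0" and [measurable]: "\<Phi> \<in> borel_measurable borel"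
  shows "((\<lambda>t. \<phi> t * measure M {x \<in> space M. t < h x}) has_integral (\<integral>x. \<Phi> (h x) \<partial>M)) {0..1}"
proof -
  define L where "L = lebesgue_on {0..1::real}"
  interpret M: finite_measure M by fact
  interpret L: finite_measure L
    unfolding L_def by (rule finite_measureI) (simp add: emeasure_restrict_space)
  interpret P: pair_sigma_finite M L ..
  interpret Pf: finite_measure "M \<Otimes>\<^sub>M L"
    by (rule finite_measure_pair_measure) unfold_locales
  have [measurable]: "\<phi> \<in> borel_measurable L"
    unfolding L_def by (rule continuous_imp_measurable_on_sets_lebesgue[OF cont]) simp
  have [measurable]: "(\<lambda>t. t) \<in> borel_measurable L"
    unfolding L_def by (rule continuous_imp_measurable_on_sets_lebesgue) (auto intro: continuous_intros)
  define f where "f x t = \<phi> t * indicator {u. u < h x} t" for x t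
  obtain B where B: "\<And>t. t \<in> {0..1} \<Longrightarrow> \<bar>\<phi> t\<bar> \<le> B"
    using compact_continuous_image[OF cont] compact_imp_bounded
    by (metis bounded_iff compact_Icc imageI real_norm_def)
  have fm[measurable]: "case_prod f \<in> borel_measurable (M \<Otimes>\<^sub>M L)"
    unfolding f_def indicator_def by measurable
  have fi: "integrable (M \<Otimes>\<^sub>M L) (case_prod f)"
  proof (rule Pf.integrable_const_bound[of _ "max B 0"])
    show "AE x in M \<Otimes>\<^sub>M L. norm (case x of (x, xa) \<Rightarrow> f x xa) \<le> max B 0"
      using B by (intro AE_I2) (force simp: f_def indicator_def space_pair_measure L_def)
  qed (rule fm)
  have inner: "(\<integral>t. f x t \<partial>L) = \<Phi> (h x)" if "0 \<le> h x" "h x \<le> 1" for x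
  proof -
    have "integrable L (f x)"
    proof (rule L.integrable_const_bound[of _ "max B 0"])
      show "AE t in L. norm (f x t) \<le> max B 0"
        using B by (intro AE_I2) (force simp: f_def indicator_def L_def)
      show "f x \<in> borel_measurable L"
        unfolding f_def indicator_def by measurable
    qed
    then have 1: "(f x has_integral (\<integral>t. f x t \<partial>L)) {0..1}"
      unfolding L_def by (rule has_integral_integral_lebesgue_on) simp
    have "(\<phi> has_integral (\<Phi> (h x) - \<Phi> 0)) {0..h x}"
      using that
      by (intro fundamental_theorem_of_calculus_interior continuous_on_subset[OF cont_\<Phi>])
         (auto simp: has_real_derivative_iff_has_vector_derivative[symmetric] intro!: deriv)
    then have "((\<lambda>t. if t \<in> {0..h x} then \<phi> t else 0) has_integral \<Phi> (h x)) {0..1}"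
      using that \<open>\<Phi> 0 = 0\<close> by (subst has_integral_restrict) auto
    \<comment> \<open>The indicator in \<open>f x\<close> is strict while the interval
      \<open>{0..h x}\<close> is closed, so the two integrands can differ only at
      \<open>t = h x\<close>.\<close>
    then have "(f x has_integral \<Phi> (h x)) {0..1}"
      by (rule has_integral_spike[of "{h x}", rotated 2]) (auto simp: f_def indicator_def)
    with 1 show ?thesis by (rule has_integral_unique)
  qed
  have outer: "(\<integral>x. f x t \<partial>M) = \<phi> t * measure M {x \<in> space M. t < h x}" for t
  proof -
    have "(\<integral>x. f x t \<partial>M) = (\<integral>x. \<phi> t * indicator {x \<in> space M. t < h x} x \<partial>M)"
      by (rule Bochner_Integration.integral_cong) (auto simp: f_def indicator_def)
    also have "\<dots> = \<phi> t * measure M {x \<in> space M. t < h x}" 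
      by (simp add: Int_absorb2 subset_eq)
    finally show ?thesis .
  qed
  have m: "(\<lambda>x. \<integral>t. f x t \<partial>L) \<in> borel_measurable M"
    by measurable
  have "integrable L (\<lambda>t. \<integral>x. f x t \<partial>M)"
    using P.integrable_snd[OF fi] .
  then have "((\<lambda>t. \<integral>x. f x t \<partial>M) has_integral (\<integral>t. \<integral>x. f x t \<partial>M \<partial>L)) {0..1}"
    unfolding L_def by (rule has_integral_integral_lebesgue_on) simp
  also have "(\<integral>t. \<integral>x. f x t \<partial>M \<partial>L) = (\<integral>x. \<integral>t. f x t \<partial>L \<partial>M)"
    by (rule P.Fubini_integral[OF fi])
  also have "\<dots> = (\<integral>x. \<Phi> (h x) \<partial>M)"
  proof (rule integral_cong_AE[OF m])
    show "(\<lambda>x. \<Phi> (h x)) \<in> borel_measurable M" by measurable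
    show "AE x in M. (\<integral>t. f x t \<partial>L) = \<Phi> (h x)"
      using h by eventually_elim (simp add: inner)
  qed
  finally show ?thesis unfolding outer .
qed

text \<open>Compare $V$ with the multiple of $(1 - t)^N$ that agrees with it at the zero of $\varphi$.\<close>
lemma single_crossing_integral_nonneg:
  fixes \<phi> V :: "real \<Rightarrow> real"
  assumes "N > 0"
    and scale: "\<And>s t. 0 \<le> s \<Longrightarrow> s < t \<Longrightarrow> t < 1 \<Longrightarrow> ((1 - t) / (1 - s)) ^ N * V s \<le> V t"
    and "0 \<le> V 1"
    and cont: "continuous_on {0..1} \<phi>" and mono: "mono_on {0..1} \<phi>" and neg: "\<phi> 0 < 0"
    and zero: "((\<lambda>t. \<phi> t * (1 - t) ^ N) has_integral 0) {0..1}"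
    and I: "((\<lambda>t. \<phi> t * V t) has_integral I) {0..1}"
  shows "0 \<le> I"
proof -
  \<comment> \<open>Otherwise \<open>- (\<phi> t * (1 - t) ^ N)\<close> would be continuous and
    nonnegative with integral 0, hence 0 at \<open>t = 0\<close>, against
    \<open>\<phi> 0 < 0\<close>. A positive value then yields the zero \<open>t0\<close> of
    \<open>\<phi>\<close>.\<close>
  have "\<exists>t\<in>{0<..<1}. 0 < \<phi> t"
  proof (rule ccontr)
    assume "\<not> (\<exists>t\<in>{0<..<1}. 0 < \<phi> t)"
    then have le: "\<phi> t \<le> 0" if "0 < t" "t < 1" for t using that by force
    have "((\<lambda>t. - (\<phi> t * (1 - t) ^ N)) has_integral 0) {0..1}"
      using has_integral_neg[OF zero] by simp
    then have "- (\<phi> 0 * (1 - 0) ^ N) = 0"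
      using le
      by (intro has_integral_0_cbox_imp_0[of 0 1 "\<lambda>t. - (\<phi> t * (1 - t) ^ N)" 0])
         (auto intro!: continuous_intros cont mult_nonpos_nonneg)
    with neg show False by simp
  qed
  then obtain t1 where t1: "0 < t1" "t1 < 1" "0 < \<phi> t1" by auto
  have "\<exists>t\<ge>0. t \<le> t1 \<and> \<phi> t = 0"
    using t1 neg by (intro IVT') (auto intro: continuous_on_subset[OF cont])
  then obtain t0 where t0: "0 \<le> t0" "t0 < 1" "\<phi> t0 = 0" using t1 by auto
  define g where "g = V t0 / (1 - t0) ^ N"
  have "((\<lambda>t. g * (\<phi> t * (1 - t) ^ N)) has_integral g * 0) {0..1}"
    by (rule has_integral_mult_right[OF zero])
  then have "g * 0 \<le> I"
  proof (rule has_integral_le[OF _ I])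
    fix t :: real assume t: "t \<in> {0..1}"
    consider "t < t0" | "t = t0" | "t0 < t" "t < 1" | "t = 1" using t by force
    then show "g * (\<phi> t * (1 - t) ^ N) \<le> \<phi> t * V t"
    proof cases
      case 1
      have "\<phi> t \<le> 0" using mono_onD[OF mono, of t t0] t t0 1 by auto
      moreover have "V t \<le> g * (1 - t) ^ N"
        using scale[of t t0] t t0 1 by (simp add: g_def field_simps power_divide)
      ultimately show ?thesis
        using mult_left_mono_neg[of "V t" "g * (1 - t) ^ N" "\<phi> t"] by (simp add: algebra_simps)
    next
      case 2 then show ?thesis by (simp add: t0)
    next
      case 3
      have "0 \<le> \<phi> t" using mono_onD[OF mono, of t0 t] t t0 3 by auto
      moreover have "g * (1 - t) ^ N \<le> V t"
        using scale[of t0 t] t0 3 by (simp add: g_def field_simps power_divide)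
      ultimately show ?thesis
        using mult_left_mono[of "g * (1 - t) ^ N" "V t" "\<phi> t"] by (simp add: algebra_simps)
    next
      \<comment> \<open>The hypothesis \<open>scale\<close> stops short of \<open>t = 1\<close>.
        There \<open>(1 - t) ^ N\<close> vanishes because \<open>N > 0\<close>, and the signs of
        \<open>\<phi> 1\<close> and \<open>V 1\<close> suffice.\<close>
      case 4
      have "0 \<le> \<phi> 1" using mono_onD[OF mono, of t0 1] t0 by auto
      with 4 \<open>0 \<le> V 1\<close> \<open>N > 0\<close> show ?thesis by (simp add: zero_power)
    qed
  qed
  then show ?thesis by simp
qed

section \<open>Superlevel sets of a concave function\<close>

text \<open>If \<open>k x0 > r\<close>, concavity makes a contraction toward \<open>x0\<close> carry
  the set \<open>k > s\<close> into the set \<open>k > t\<close>, and it scales measure by a power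
  of its ratio. The value 1 need not be attained by \<open>k\<close>, so the estimate is proved for
  each \<open>r\<close> in \<open>(t, 1)\<close> first.\<close>

lemma concave_superlevel_measure_scaling:
  fixes A :: "'a::euclidean_space set" and k :: "'a \<Rightarrow> real"
  assumes "convex A" "bounded A" and A[measurable]: "A \<in> sets lebesgue"
    and conc: "concave_on A k" and k[measurable]: "k \<in> borel_measurable (lebesgue_on A)"
    and near: "\<And>r. r < 1 \<Longrightarrow> \<exists>x\<in>A. r < k x" and st: "s < t" "t < 1"
  shows "((1 - t) / (1 - s)) ^ DIM('a) * measure (lebesgue_on A) {x \<in> A. s < k x}
         \<le> measure (lebesgue_on A) {x \<in> A. t < k x}"
proof -
  define S where "S u = {x \<in> A. u < k x}" for u
  have S: "S u \<in> sets lebesgue" for u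
  proof -
    have "{x \<in> space (lebesgue_on A). u < k x} \<in> sets (lebesgue_on A)" by measurable
    then show ?thesis by (auto simp: S_def sets_restrict_space_iff)
  qed
  then have Sl: "S u \<in> lmeasurable" for u
    using \<open>bounded A\<close> bounded_subset[of A "S u"]
    by (intro bounded_set_imp_lmeasurable) (auto simp: S_def)
  have mS: "measure (lebesgue_on A) {x \<in> A. u < k x} = measure lebesgue (S u)" for u
    using A by (subst measure_restrict_space) (auto simp: S_def)
  have step: "((r - t) / (r - s)) ^ DIM('a) * measure lebesgue (S s) \<le> measure lebesgue (S t)"
    if r: "t < r" "r < 1" for r
  proof -
    obtain x0 where x0: "x0 \<in> A" "r < k x0" using near[OF r(2)] by auto
    \<comment> \<open>The ratio \<open>l\<close> solves
      \<open>(1 - l) * r + l * s = t\<close>.\<close>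
    define l where "l = (r - t) / (r - s)"
    have "l * (r - s) = r - t" using st r by (simp add: l_def)
    moreover have "0 < l" "l < 1" using st r by (auto simp: l_def)
    ultimately have l: "0 < l" "l < 1" "(1 - l) * r + l * s = t" by (auto simp: algebra_simps)
    have "(\<lambda>x. l *\<^sub>R x + (1 - l) *\<^sub>R x0) ` S s \<subseteq> S t"
    proof clarify
      fix x assume x: "x \<in> S s"
      then have xA: "x \<in> A" "s < k x" by (auto simp: S_def)
      have "t < (1 - l) * k x0 + l * k x"
        using l(3) mult_strict_left_mono[OF x0(2), of "1 - l"] mult_strict_left_mono[OF xA(2), of l] l
        by linarith
      also have "\<dots> \<le> k ((1 - l) *\<^sub>R x0 + l *\<^sub>R x)"
        using l x0 xA by (intro concave_onD[OF conc]) auto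
      finally have "t < k (l *\<^sub>R x + (1 - l) *\<^sub>R x0)" by (simp add: add.commute)
      moreover have "l *\<^sub>R x + (1 - l) *\<^sub>R x0 \<in> A"
        using l x0 xA by (intro convexD[OF \<open>convex A\<close>]) auto
      ultimately show "l *\<^sub>R x + (1 - l) *\<^sub>R x0 \<in> S t" by (simp add: S_def)
    qed
    moreover have "(\<lambda>x. l *\<^sub>R x + (1 - l) *\<^sub>R x0) ` S s \<in> sets lebesgue"
      by (intro differentiable_image_in_sets_lebesgue S) (auto intro!: derivative_intros)
    ultimately have "measure lebesgue ((\<lambda>x. l *\<^sub>R x + (1 - l) *\<^sub>R x0) ` S s) \<le> measure lebesgue (S t)"
      by (rule measure_mono_fmeasurable[OF _ _ Sl])
    then have "l ^ DIM('a) * measure lebesgue (S s) \<le> measure lebesgue (S t)"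
      using l(1) by (simp add: measure_lebesgue_affine)
    then show ?thesis by (simp only: l_def)
  qed
  \<comment> \<open>The right-hand side of \<open>step\<close> does not depend on \<open>r\<close>,
    so letting \<open>r\<close> increase to 1 gives the sharp ratio.\<close>
  have "((\<lambda>r. ((r - t) / (r - s)) ^ DIM('a) * measure lebesgue (S s)) \<longlongrightarrow>
         ((1 - t) / (1 - s)) ^ DIM('a) * measure lebesgue (S s)) (at_left 1)"
    using st by (intro tendsto_intros) auto
  then have "((1 - t) / (1 - s)) ^ DIM('a) * measure lebesgue (S s) \<le> measure lebesgue (S t)"
    by (rule tendsto_upperbound)
       (use st step in \<open>auto simp: eventually_at_left[of t 1] intro!: exI[of _ t]\<close>)
  then show ?thesis by (simp add: mS)
qed

section \<open>Beta integrals and the moment inequality\<close>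

lemma Gamma_plus1_pos: "0 < (z::real) \<Longrightarrow> Gamma (z + 1) = z * Gamma z"
  by (intro Gamma_plus1) (auto dest: nonpos_Ints_nonpos)

text \<open>The integral is \<open>a * Beta a (N + 1)\<close>; absorbing \<open>a\<close> into
  \<open>Gamma a\<close> leaves the reciprocal of a binomial coefficient.\<close>

lemma has_integral_powr_one_minus_power:
  assumes "0 < a"
  shows "((\<lambda>t. a * t powr (a - 1) * (1 - t) ^ N) has_integral 1 / real_binomial (real N + a) N) {0..1}"
proof -
  have "((\<lambda>t. a * (t powr (a - 1) * (1 - t) powr (real N + 1 - 1))) has_integral
         a * Beta a (real N + 1)) {0..1}"
    using assms by (intro has_integral_mult_right has_integral_Beta_real) auto
  moreover have "a * Beta a (real N + 1) = 1 / real_binomial (real N + a) N"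
    using Gamma_plus1_pos[OF assms] by (simp add: Beta_def real_binomial_def add_ac)
  ultimately have "((\<lambda>t. a * (t powr (a - 1) * (1 - t) powr (real N + 1 - 1))) has_integral
      1 / real_binomial (real N + a) N) {0..1}" by simp
  then show ?thesis
    \<comment> \<open>At \<open>t = 1\<close> the two powers disagree when \<open>N = 0\<close>,
      since \<open>0 powr 0 = 0\<close> but \<open>0 ^ 0 = 1\<close>.\<close>
    by (rule has_integral_spike[of "{1}", rotated 2]) (auto simp: powr_realpow mult.assoc)
qed

lemma real_binomial_pos: "0 < a \<Longrightarrow> 0 < real_binomial (real N + a) N"
  by (auto simp: real_binomial_def intro!: divide_pos_pos mult_pos_pos Gamma_real_pos)

lemma real_binomial_Suc_self: "real_binomial (real N + 1) N = real N + 1"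
proof -
  have "Gamma (real N + 2) = (real N + 1) * Gamma (real N + 1)"
    using Gamma_plus1_pos[of "real N + 1"] by (simp add: add_ac)
  moreover have "Gamma (real N + 1) \<noteq> 0" 
    using Gamma_real_pos[of "real N + 1"] by linarith
  ultimately show ?thesis
    by (simp add: real_binomial_def add_ac Gamma_numeral)
qed

text \<open>The value of $\int k^a / \int k$ for the cone $k(x) = 1 - |x|$ on the unit ball of $\mathbb{R}^N$.\<close>
definition moment_ratio :: "nat \<Rightarrow> real \<Rightarrow> real" where
  "moment_ratio N a = (real N + 1) / real_binomial (real N + a) N"

lemma moment_ratio_pos: "0 < a \<Longrightarrow> 0 < moment_ratio N a"
  by (simp add: moment_ratio_def real_binomial_pos)

text \<open>Both terms are Beta integrals, the second being the case of exponent 1, and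
  \<open>moment_ratio\<close> is their quotient. This is the \<open>zero\<close> hypothesis of the
  crossing lemma.\<close>

lemma has_integral_moment_ratio:
  assumes "1 < a"
  shows "((\<lambda>t. (a * t powr (a - 1) - moment_ratio N a) * (1 - t) ^ N) has_integral 0) {0..1}"
proof -
  have "((\<lambda>t. 1 * t powr (1 - 1) * (1 - t) ^ N) has_integral 1 / real_binomial (real N + 1) N) {0..1}"
    by (rule has_integral_powr_one_minus_power) simp
  then have "((\<lambda>t. (1 - t) ^ N) has_integral 1 / (real N + 1)) {0..1::real}"
    unfolding real_binomial_Suc_self
    by (rule has_integral_spike[of "{0}", rotated 2]) auto
  then have "((\<lambda>t. a * t powr (a - 1) * (1 - t) ^ N - moment_ratio N a * (1 - t) ^ N) has_integral
     1 / real_binomial (real N + a) N - moment_ratio N a * (1 / (real N + 1))) {0..1}"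
    using assms by (intro has_integral_diff has_integral_powr_one_minus_power has_integral_mult_right) auto
  then show ?thesis
    by (simp add: moment_ratio_def algebra_simps)
qed

text \<open>The layer cake formula for the antiderivative \<open>t powr a - c * t\<close> treats
  both moments at once; \<open>1 < a\<close> makes the weight continuous at 0.\<close>

lemma layer_cake_moment_ratio:
  assumes "finite_measure M" "h \<in> borel_measurable M" "AE x in M. 0 \<le> h x \<and> h x \<le> 1" "1 < a"
  shows "((\<lambda>t. (a * t powr (a - 1) - c) * measure M {x \<in> space M. t < h x}) has_integral
          (\<integral>x. h x powr a \<partial>M) - c * (\<integral>x. h x \<partial>M)) {0..1}"
proof -
  interpret finite_measure M by fact
  note [measurable] = assms(2)
  have "((\<lambda>t. (a * t powr (a - 1) - c) * measure M {x \<in> space M. t < h x}) has_integral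
          (\<integral>x. h x powr a - c * h x \<partial>M)) {0..1}"
  proof (rule layer_cake_has_integral[OF assms(1-3)])
    show "continuous_on {0..1} (\<lambda>t. a * t powr (a - 1) - c)"
      using assms(4) by (auto intro!: continuous_intros continuous_on_powr')
    show "continuous_on {0..1} (\<lambda>t. t powr a - c * t)"
      using assms(4) by (auto intro!: continuous_intros continuous_on_powr')
    show "((\<lambda>t. t powr a - c * t) has_real_derivative a * t powr (a - 1) - c) (at t)"
      if "t \<in> {0<..<1}" for t
      using that by (auto intro!: derivative_eq_intros has_real_derivative_powr)
  qed auto
  moreover have "integrable M h"
    using assms(3) by (intro integrable_const_bound[of _ 1]) auto
  moreover have "integrable M (\<lambda>x. h x powr a)"
  proof (rule integrable_const_bound[of _ 1])
    show "AE x in M. norm (h x powr a) \<le> 1"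
      using assms(3) by (rule eventually_mono) (use assms(4) in \<open>auto intro: powr_le1\<close>)
  qed measurable
  ultimately show ?thesis by simp
qed

text \<open>The crossing lemma applies because the weight increases for \<open>1 < a\<close> and
  equals \<open>- moment_ratio DIM('a) a\<close> at 0. The hypotheses \<open>near\<close> and
  \<open>bd\<close> are what division by the essential supremum provides: values arbitrarily close
  to 1, and the bound \<open>k x \<le> 1\<close> only almost everywhere.\<close>

lemma concave_moment_bound:
  fixes A :: "'a::euclidean_space set" and k :: "'a \<Rightarrow> real"
  assumes "convex A" "bounded A" "A \<in> sets lebesgue"
    and "concave_on A k" and k: "k \<in> borel_measurable (lebesgue_on A)"
    and near: "\<And>r. r < 1 \<Longrightarrow> \<exists>x\<in>A. r < k x"
    and bd: "AE x in lebesgue_on A. 0 \<le> k x \<and> k x \<le> 1" and a: "1 < a"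
  shows "moment_ratio DIM('a) a * (\<integral>x. k x \<partial>lebesgue_on A) \<le> (\<integral>x. k x powr a \<partial>lebesgue_on A)"
proof -
  have fin: "finite_measure (lebesgue_on A)"
    using bounded_set_imp_lmeasurable[OF assms(2,3)] assms(3)
    by (intro finite_measureI) (simp add: emeasure_restrict_space fmeasurable_def)
  have "0 \<le> (\<integral>x. k x powr a \<partial>lebesgue_on A) - moment_ratio DIM('a) a * (\<integral>x. k x \<partial>lebesgue_on A)"
  proof (rule single_crossing_integral_nonneg[of "DIM('a)" _ "\<lambda>t. a * t powr (a - 1) - moment_ratio DIM('a) a"])
    show "((\<lambda>t. (a * t powr (a - 1) - moment_ratio DIM('a) a) * measure (lebesgue_on A) {x \<in> A. t < k x})
      has_integral (\<integral>x. k x powr a \<partial>lebesgue_on A) - moment_ratio DIM('a) a * (\<integral>x. k x \<partial>lebesgue_on A)) {0..1}"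
      using layer_cake_moment_ratio[OF fin k bd a] by simp
    show "((1 - t) / (1 - s)) ^ DIM('a) * measure (lebesgue_on A) {x \<in> A. s < k x}
         \<le> measure (lebesgue_on A) {x \<in> A. t < k x}" if "0 \<le> s" "s < t" "t < 1" for s t
      using that by (intro concave_superlevel_measure_scaling assms)
    show "continuous_on {0..1} (\<lambda>t. a * t powr (a - 1) - moment_ratio DIM('a) a)"
      using a by (auto intro!: continuous_intros continuous_on_powr')
    show "mono_on {0..1} (\<lambda>t. a * t powr (a - 1) - moment_ratio DIM('a) a)"
      using a by (auto intro!: mono_onI powr_mono2)
    show "((\<lambda>t. (a * t powr (a - 1) - moment_ratio DIM('a) a) * (1 - t) ^ DIM('a)) has_integral 0) {0..1}"
      by (rule has_integral_moment_ratio[OF a])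
  qed (use a moment_ratio_pos in auto)
  then show ?thesis by simp
qed

section \<open>The cone over the unit ball\<close>

lemma emeasure_lebesgue_ball_finite: "emeasure lebesgue (ball c r) < \<infinity>"
  using emeasure_lborel_ball_finite[of c r] by simp

lemma ball_superlevel_measure:
  assumes "0 \<le> t" "t \<le> 1"
  shows "measure (lebesgue_on (ball 0 1)) {x \<in> ball (0::'a::euclidean_space) 1. t < 1 - norm x}
         = measure lebesgue (ball (0::'a) 1) * (1 - t) ^ DIM('a)"
proof -
  have "{x \<in> ball (0::'a) 1. t < 1 - norm x} = ball 0 (1 - t)"
    using assms by auto
  moreover have "ball 0 (1 - t) \<subseteq> ball (0::'a) 1" using assms by auto
  ultimately show ?thesis
    using content_ball_conv_unit_ball[of "1 - t" "0::'a"] assms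
    by (simp add: measure_restrict_space mult.commute)
qed

text \<open>Equality case: the superlevel sets are concentric balls, so their measure is an exact
  multiple of \<open>(1 - t) ^ DIM('a)\<close> and the layer cake integral vanishes.\<close>

lemma ball_moment_eq:
  assumes a: "1 < a"
  shows "(\<integral>x. (1 - norm x) powr a \<partial>lebesgue_on (ball (0::'a::euclidean_space) 1))
         = moment_ratio DIM('a) a * (\<integral>x. 1 - norm x \<partial>lebesgue_on (ball (0::'a) 1))"
proof -
  let ?L = "lebesgue_on (ball (0::'a) 1)"
  let ?\<phi> = "\<lambda>t. a * t powr (a - 1) - moment_ratio DIM('a) a"
  let ?I = "(\<integral>x. (1 - norm x) powr a \<partial>?L) - moment_ratio DIM('a) a * (\<integral>x. 1 - norm x \<partial>?L)"
  have fin: "finite_measure ?L"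
    using emeasure_lebesgue_ball_finite[of "0::'a" 1]
    by (intro finite_measureI) (simp add: emeasure_restrict_space)
  have "((\<lambda>t. ?\<phi> t * measure ?L {x \<in> ball 0 1. t < 1 - norm x}) has_integral ?I) {0..1}"
  proof -
    have "(\<lambda>x. 1 - norm x) \<in> borel_measurable ?L"
      by (auto intro!: continuous_imp_measurable_on_sets_lebesgue continuous_intros)
    moreover have "AE x in ?L. 0 \<le> 1 - norm x \<and> 1 - norm x \<le> 1"
      by (rule AE_I2) simp
    ultimately show ?thesis
      using layer_cake_moment_ratio[OF fin _ _ a] by simp
  qed
  then have "((\<lambda>t. measure lebesgue (ball (0::'a) 1) * (?\<phi> t * (1 - t) ^ DIM('a))) has_integral ?I) {0..1}"
    by (rule has_integral_eq[rotated]) (subst ball_superlevel_measure, auto)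
  moreover have "((\<lambda>t. measure lebesgue (ball (0::'a) 1) * (?\<phi> t * (1 - t) ^ DIM('a))) has_integral
      measure lebesgue (ball (0::'a) 1) * 0) {0..1}"
    by (intro has_integral_mult_right has_integral_moment_ratio a)
  ultimately have "?I = measure lebesgue (ball (0::'a) 1) * 0"
    by (rule has_integral_unique)
  then show ?thesis by simp
qed

section \<open>The essential supremum norm\<close>

text \<open>A real number strictly between the essential supremum and \<open>m\<close> would be an
  almost everywhere bound, against \<open>least\<close>.\<close>

lemma Linf_norm_eqI:
  assumes "f \<in> borel_measurable (lebesgue_on A)" "AE x in lebesgue_on A. \<bar>f x\<bar> \<le> m"
    and least: "\<And>r. r < m \<Longrightarrow> \<not> (AE x in lebesgue_on A. \<bar>f x\<bar> \<le> r)"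
  shows "Linf_norm A f = m"
proof -
  let ?E = "esssup (lebesgue_on A) (\<lambda>x. ereal \<bar>f x\<bar>)"
  have "?E \<le> ereal m" using assms(1,2) by (intro esssup_I) auto
  moreover have "\<not> ?E < ereal m"
  proof
    assume "?E < ereal m"
    then obtain r where r: "?E < ereal r" "ereal r < ereal m" using ereal_dense2 by blast
    have "AE x in lebesgue_on A. ereal \<bar>f x\<bar> \<le> ?E" by (rule esssup_AE)
    then have "AE x in lebesgue_on A. \<bar>f x\<bar> \<le> r"
      using r(1) by (auto elim!: eventually_mono dest: order.trans order.strict_implies_order)
    with least[of r] r(2) show False by simp
  qed
  ultimately have "?E = ereal m" by order
  then show ?thesis by (simp add: Linf_norm_def)
qed

lemma admissible_Linf_norm:
  assumes "admissible A h"
  shows "0 < Linf_norm A h" and "AE x in lebesgue_on A. h x \<le> Linf_norm A h"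
    and "\<And>r. r < Linf_norm A h \<Longrightarrow> \<exists>x\<in>A. r < h x"
proof -
  let ?E = "esssup (lebesgue_on A) (\<lambda>x. ereal \<bar>h x\<bar>)"
  have m: "h \<in> borel_measurable (lebesgue_on A)" and nn: "\<And>x. x \<in> A \<Longrightarrow> 0 \<le> h x"
    and nz: "\<not> (AE x in lebesgue_on A. h x = 0)" and bd: "bounded (h ` A)"
    using assms by (auto simp: admissible_def)
  have le: "?E \<le> ereal r" if "\<And>x. x \<in> A \<Longrightarrow> h x \<le> r" for r
    using m nn that by (intro esssup_I AE_I2) auto
  obtain B where "\<And>x. x \<in> A \<Longrightarrow> h x \<le> B"
    using bounded_imp_bdd_above[OF bd] unfolding bdd_above_def by blast
  then have "?E \<le> ereal B" by (rule le)
  have ae: "AE x in lebesgue_on A. ereal \<bar>h x\<bar> \<le> ?E" by (rule esssup_AE)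
  have "0 < ?E"
  proof (rule ccontr)
    assume "\<not> 0 < ?E"
    then have "AE x in lebesgue_on A. h x = 0"
      using ae by (auto elim!: eventually_mono simp: not_less dest: order.trans)
    with nz show False by simp
  qed
  \<comment> \<open>Being positive and at most \<open>B\<close>, the essential supremum is finite,
    so \<open>real_of_ereal\<close> does not fall back to its default value.\<close>
  with \<open>?E \<le> ereal B\<close> have E: "?E = ereal (Linf_norm A h)"
    unfolding Linf_norm_def by (cases ?E) auto
  show "0 < Linf_norm A h" using \<open>0 < ?E\<close> by (simp add: E)
  show "AE x in lebesgue_on A. h x \<le> Linf_norm A h"
    using ae unfolding E by (auto elim!: eventually_mono)
  show "\<exists>x\<in>A. r < h x" if "r < Linf_norm A h" for r
    using le[of r] that unfolding E by force
qed


section \<open>Bounds for the functional\<close>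

lemma gamma_p_nonneg: "0 \<le> gamma_p p"
  by (simp add: gamma_p_def)

lemma conj_exp_pos: "1 < p \<Longrightarrow> 0 < conj_exp p"
  by (simp add: conj_exp_def)

text \<open>With \<open>N = d - 1\<close> and \<open>a = conj_exp p\<close>, this turns the sharp
  constant into the binomial form of the theorem.\<close>

lemma moment_ratio_powr:
  "moment_ratio N (a + 1) powr (p - 1)
   = real (Suc N) powr (p - 1) * real_binomial (real (Suc N) + a) N powr (1 - p)"
  if "0 < a"
proof -
  have eq: "real (Suc N) + a = real N + (a + 1)" by simp
  have "0 < real_binomial (real N + (a + 1)) N"
    using that by (intro real_binomial_pos) simp
  moreover have "x powr (1 - p) = 1 / x powr (p - 1)" for x :: real
    using powr_minus_divide[of x "p - 1"] by simp
  ultimately show ?thesis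
    unfolding eq by (simp add: moment_ratio_def powr_divide add.commute)
qed

lemma bounded_imp_integrable_powr:
  fixes h :: "'a::euclidean_space \<Rightarrow> real"
  assumes "emeasure lebesgue A < \<infinity>" "A \<in> sets lebesgue" and [measurable]: "h \<in> borel_measurable (lebesgue_on A)"
    and "bounded (h ` A)" "\<And>x. x \<in> A \<Longrightarrow> 0 \<le> h x" and "0 \<le> a"
  shows "integrable (lebesgue_on A) (\<lambda>x. h x powr a)"
proof -
  interpret finite_measure "lebesgue_on A"
    using assms by (intro finite_measureI) (simp add: emeasure_restrict_space)
  obtain B where "\<And>x. x \<in> A \<Longrightarrow> h x \<le> B"
    using bounded_imp_bdd_above[OF assms(4)] unfolding bdd_above_def by blast
  then show ?thesis
    using assms(5,6) by (intro integrable_const_bound[of _ "B powr a"] AE_I2) (auto intro!: powr_mono2)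
qed

text \<open>Makes the denominator of \<open>F_p1\<close> a genuine positive number, so that
  quotients may be cleared.\<close>

lemma admissible_integral_pos:
  assumes "admissible A h" "emeasure lebesgue A < \<infinity>"
  shows "integrable (lebesgue_on A) h" "0 < (\<integral>x. h x \<partial>lebesgue_on A)"
proof -
  have h: "open A" "h \<in> borel_measurable (lebesgue_on A)" "bounded (h ` A)"
    "\<And>x. x \<in> A \<Longrightarrow> 0 \<le> h x" "\<not> (AE x in lebesgue_on A. h x = 0)"
    using assms(1) by (auto simp: admissible_def)
  have "integrable (lebesgue_on A) (\<lambda>x. h x powr 1)"
    using assms(2) h by (intro bounded_imp_integrable_powr) auto
  then show i: "integrable (lebesgue_on A) h"
    by (rule Bochner_Integration.integrable_cong[THEN iffD1, rotated 2]) (use h(4) in auto)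
  have "0 \<le> (\<integral>x. h x \<partial>lebesgue_on A)"
    using h(4) by (intro integral_nonneg_AE AE_I2) auto
  moreover have "(\<integral>x. h x \<partial>lebesgue_on A) \<noteq> 0"
    using h by (subst integral_nonneg_eq_0_iff_AE[OF i AE_I2]) auto
  ultimately show "0 < (\<integral>x. h x \<partial>lebesgue_on A)" by simp
qed

lemma F_p1_le_gamma_p:
  assumes "1 < p" "admissible A h" "emeasure lebesgue A < \<infinity>"
  shows "F_p1 p A h \<le> gamma_p p"
proof -
  define q where "q = conj_exp p"
  define m where "m = Linf_norm A h"
  have q: "0 < q" unfolding q_def by (rule conj_exp_pos[OF assms(1)])
  have m: "0 < m" "AE x in lebesgue_on A. h x \<le> m"
    unfolding m_def using admissible_Linf_norm[OF assms(2)] by auto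
  have h: "open A" "h \<in> borel_measurable (lebesgue_on A)" "bounded (h ` A)"
    "\<And>x. x \<in> A \<Longrightarrow> 0 \<le> h x"
    using assms(2) by (auto simp: admissible_def)
  note I = admissible_integral_pos[OF assms(2,3)]
  have "(\<integral>x. h x powr (q + 1) \<partial>lebesgue_on A) \<le> (\<integral>x. m powr q * h x \<partial>lebesgue_on A)"
  proof (rule integral_mono_AE)
    show "integrable (lebesgue_on A) (\<lambda>x. h x powr (q + 1))"
      using assms(3) h q by (intro bounded_imp_integrable_powr) auto
    have "AE x in lebesgue_on A. x \<in> A" by (rule AE_I2) simp
    with m(2) show "AE x in lebesgue_on A. h x powr (q + 1) \<le> m powr q * h x"
    proof eventually_elim
      case (elim x)
      with h(4)[of x] q have "h x powr q * h x \<le> m powr q * h x"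
        by (intro mult_right_mono powr_mono2) auto
      with h(4)[of x] elim show ?case by (simp add: powr_add)
    qed
  qed (use I in simp)
  then have "(\<integral>x. h x powr (q + 1) \<partial>lebesgue_on A) / (m powr q * (\<integral>x. h x \<partial>lebesgue_on A)) \<le> 1"
    using I m by (simp add: divide_le_eq_1)
  then have "((\<integral>x. h x powr (q + 1) \<partial>lebesgue_on A) / (m powr q * (\<integral>x. h x \<partial>lebesgue_on A))) powr (p - 1) \<le> 1"
    using assms(1) I m by (intro powr_le1 divide_nonneg_pos integral_nonneg_AE) auto
  then show ?thesis
    unfolding F_p1_def q_def m_def by (intro mult_left_le gamma_p_nonneg)
qed

text \<open>The quotient inside \<open>F_p1\<close> does not change when \<open>h\<close> is
  multiplied by a positive constant, so the moment inequality is applied to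
  \<open>h / m\<close>.\<close>

lemma F_p1_ge_moment_ratio:
  fixes A :: "'a::euclidean_space set"
  assumes p: "1 < p" and "(A, h) \<in> inf_class"
  shows "gamma_p p * moment_ratio DIM('a) (conj_exp p + 1) powr (p - 1) \<le> F_p1 p A h"
proof -
  define q where "q = conj_exp p"
  define m where "m = Linf_norm A h"
  define c where "c = moment_ratio DIM('a) (q + 1)"
  have q: "0 < q" unfolding q_def by (rule conj_exp_pos[OF p])
  have adm: "admissible A h" and A: "convex A" "bounded A" and conc: "concave_on A h"
    using assms(2) by (auto simp: inf_class_def)
  then have h: "open A" "h \<in> borel_measurable (lebesgue_on A)" "bounded (h ` A)"
    "\<And>x. x \<in> A \<Longrightarrow> 0 \<le> h x"
    by (auto simp: admissible_def)
  have m: "0 < m" "AE x in lebesgue_on A. h x \<le> m" "\<And>r. r < m \<Longrightarrow> \<exists>x\<in>A. r < h x"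
    unfolding m_def using admissible_Linf_norm[OF adm] by auto
  have "A \<in> lmeasurable" using A h(1) by (intro bounded_set_imp_lmeasurable) auto
  then have "emeasure lebesgue A < \<infinity>" by (auto simp only: fmeasurable_def)
  note I = admissible_integral_pos[OF adm this]
  have "c * (\<integral>x. h x / m \<partial>lebesgue_on A) \<le> (\<integral>x. (h x / m) powr (q + 1) \<partial>lebesgue_on A)"
    unfolding c_def
  proof (rule concave_moment_bound)
    show "concave_on A (\<lambda>x. h x / m)"
      using concave_on_cmul[of "1 / m" A h] conc m(1) by simp
    show "\<exists>x\<in>A. r < h x / m" if "r < 1" for r
      using m(3)[of "r * m"] m(1) that by (auto simp: pos_less_divide_eq)
    have "AE x in lebesgue_on A. x \<in> A" by (rule AE_I2) simp
    with m(2) show "AE x in lebesgue_on A. 0 \<le> h x / m \<and> h x / m \<le> 1"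
      by eventually_elim (use h(4) m(1) in auto)
  qed (use A h q in auto)
  also have "\<dots> = (\<integral>x. h x powr (q + 1) / m powr (q + 1) \<partial>lebesgue_on A)"
    using h(4) m(1) by (intro Bochner_Integration.integral_cong) (auto simp: powr_divide)
  \<comment> \<open>The factor \<open>m powr (q + 1)\<close> on one side against \<open>m\<close> on
    the other leaves \<open>m powr q\<close>.\<close>
  finally have "c \<le> (\<integral>x. h x powr (q + 1) \<partial>lebesgue_on A) / (m powr q * (\<integral>x. h x \<partial>lebesgue_on A))"
    using I m(1) by (simp add: field_simps powr_add)
  then have "c powr (p - 1) \<le>
      ((\<integral>x. h x powr (q + 1) \<partial>lebesgue_on A) / (m powr q * (\<integral>x. h x \<partial>lebesgue_on A))) powr (p - 1)"
    using p q by (intro powr_mono2) (auto simp: c_def intro!: less_imp_le moment_ratio_pos)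
  then show ?thesis
    unfolding F_p1_def q_def[symmetric] m_def[symmetric] c_def[symmetric]
    by (intro mult_left_mono gamma_p_nonneg)
qed

text \<open>Nonempty open sets are not null. This serves both to show that a function is not almost
  everywhere zero and to rule out smaller essential bounds.\<close>

lemma not_AE_lebesgue_on_open:
  fixes A U :: "'a::euclidean_space set"
  assumes "open U" "U \<noteq> {}" "U \<subseteq> A" "\<And>x. x \<in> U \<Longrightarrow> \<not> P x" "A \<in> sets lebesgue"
  shows "\<not> (AE x in lebesgue_on A. P x)"
proof
  assume "AE x in lebesgue_on A. P x"
  then have "AE x in lebesgue. x \<in> A \<longrightarrow> P x"
    using assms(5) by (simp add: AE_restrict_space_iff)
  then have "AE x in lebesgue. x \<notin> U"
    by (rule eventually_mono) (use assms in auto)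
  then have "U \<in> null_sets lebesgue"
    using assms(1) by (simp add: AE_iff_null)
  with assms(1,2) show False
    using open_not_negligible negligible_iff_null_sets by blast
qed

section \<open>Extremal pairs and the final statement\<close>

lemma const_in_sup_class:
  fixes A :: "'a::euclidean_space set"
  assumes "open A" "A \<noteq> {}" "emeasure lebesgue A < \<infinity>" "0 < c"
  shows "(A, \<lambda>x. c) \<in> sup_class"
  using assms not_AE_lebesgue_on_open[of A A "\<lambda>x. c = 0"]
  by (auto simp: sup_class_def admissible_def image_constant_conv)

lemma F_p1_const:
  fixes A :: "'a::euclidean_space set"
  assumes "1 < p" "open A" "A \<noteq> {}" "emeasure lebesgue A < \<infinity>" "0 < c"
  shows "F_p1 p A (\<lambda>x. c) = gamma_p p"
proof -
  \<comment> \<open>Positivity forces \<open>A\<close> to have positive measure, so the quotient is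
    truly 1 and not the default value of division by 0.\<close>
  have "(\<integral>x. c \<partial>lebesgue_on A) > 0"
    using const_in_sup_class[OF assms(2-)] assms(4) admissible_integral_pos[of A "\<lambda>x. c"]
    by (simp add: sup_class_def)
  moreover have "Linf_norm A (\<lambda>x. c) = c"
    using assms not_AE_lebesgue_on_open[of A A]
    by (intro Linf_norm_eqI) auto
  ultimately show ?thesis
    using assms by (auto simp: F_p1_def powr_add zero_less_mult_iff)
qed

lemma cone_in_inf_class:
  "(ball (0::'a::euclidean_space) 1, \<lambda>x. 1 - norm x) \<in> inf_class"
proof -
  have "(\<lambda>x. 1 - norm x) ` ball (0::'a) 1 \<subseteq> {0..1}" by auto
  then have "bounded ((\<lambda>x. 1 - norm x) ` ball (0::'a) 1)"
    by (rule bounded_subset[rotated]) simp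
  \<comment> \<open>The norm is the distance to 0, hence convex.\<close>
  moreover have "concave_on (ball (0::'a) 1) (\<lambda>x. 1 - norm x)"
    using concave_on_diff[OF _ convex_on_dist[of "ball (0::'a) 1" 0], of "\<lambda>x. 1"]
    by (simp add: concave_on_const)
  ultimately show ?thesis
    using not_AE_lebesgue_on_open[of "ball (0::'a) 1" "ball (0::'a) 1" "\<lambda>x. 1 - norm x = 0"]
    by (auto simp: inf_class_def admissible_def
        intro!: continuous_imp_measurable_on_sets_lebesgue continuous_intros)
qed

lemma Linf_norm_cone: "Linf_norm (ball (0::'a::euclidean_space) 1) (\<lambda>x. 1 - norm x) = 1"
proof (rule Linf_norm_eqI)
  show "(\<lambda>x. 1 - norm x) \<in> borel_measurable (lebesgue_on (ball (0::'a) 1))"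
    by (auto intro!: continuous_imp_measurable_on_sets_lebesgue continuous_intros)
  show "AE x in lebesgue_on (ball (0::'a) 1). \<bar>1 - norm x\<bar> \<le> 1"
    by (rule AE_I2) auto
  show "\<not> (AE x in lebesgue_on (ball (0::'a) 1). \<bar>1 - norm x\<bar> \<le> r)" if "r < 1" for r
    \<comment> \<open>Where \<open>norm x < 1 - r\<close> the function exceeds \<open>r\<close>; the
      minimum with 1 keeps the witness inside the unit ball, also for negative
      \<open>r\<close>.\<close>
    using that by (intro not_AE_lebesgue_on_open[of "ball 0 (min 1 (1 - r))"]) auto
qed

lemma F_p1_cone:
  assumes "1 < p"
  shows "F_p1 p (ball (0::'a::euclidean_space) 1) (\<lambda>x. 1 - norm x)
         = gamma_p p * moment_ratio DIM('a) (conj_exp p + 1) powr (p - 1)"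
proof -
  have "0 < (\<integral>x. 1 - norm x \<partial>lebesgue_on (ball (0::'a) 1))"
    using cone_in_inf_class[where 'a='a]
    by (intro admissible_integral_pos emeasure_lebesgue_ball_finite) (simp add: inf_class_def)
  then show ?thesis
    using conj_exp_pos[OF assms]
    by (simp add: F_p1_def Linf_norm_cone ball_moment_eq)
qed

text \<open>The dimension \<open>d - 1\<close> is carried by the index type \<open>'n\<close>. The
  extrema are taken in \<open>ereal\<close>, a complete lattice, so their equality with real values
  includes finiteness.\<close>

theorem theorem4p4:
  fixes d :: nat and p :: real
  assumes "d \<ge> 2" and "CARD('n::finite) = d - 1" and "1 < p"
  shows "((SUP (A, h) \<in> (sup_class :: ((real ^ 'n) set \<times> (real ^ 'n \<Rightarrow> real)) set).
            ereal (F_p1 p A h)) = ereal (gamma_p p))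
    \<and> ((INF (A, h) \<in> (inf_class :: ((real ^ 'n) set \<times> (real ^ 'n \<Rightarrow> real)) set).
            ereal (F_p1 p A h)) =
         ereal (gamma_p p * real d powr (p - 1) *
                real_binomial (real d + conj_exp p) (d - 1) powr (1 - p)))
    \<and> (\<forall>(A :: (real ^ 'n) set) (c :: real).
           open A \<and> A \<noteq> {} \<and> emeasure lebesgue A < \<infinity> \<and> 0 < c \<longrightarrow>
           (A, \<lambda>x. c) \<in> sup_class \<and> F_p1 p A (\<lambda>x. c) = gamma_p p)
    \<and> ((ball (0 :: real ^ 'n) 1, \<lambda>x. 1 - norm x) \<in> inf_class \<and>
         F_p1 p (ball (0 :: real ^ 'n) 1) (\<lambda>x. 1 - norm x) =
           gamma_p p * real d powr (p - 1) *
           real_binomial (real d + conj_exp p) (d - 1) powr (1 - p))"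
proof -
  let ?B = "ball (0 :: real ^ 'n) 1"
  let ?m = "gamma_p p * real d powr (p - 1) * real_binomial (real d + conj_exp p) (d - 1) powr (1 - p)"
  have m: "gamma_p p * moment_ratio DIM(real ^ 'n) (conj_exp p + 1) powr (p - 1) = ?m"
    using moment_ratio_powr[OF conj_exp_pos[OF assms(3)], of "d - 1" p] assms(1,2)
    by (simp add: mult.assoc)
  have const: "(A, \<lambda>x. c) \<in> sup_class \<and> F_p1 p A (\<lambda>x. c) = gamma_p p"
    if "open A \<and> A \<noteq> {} \<and> emeasure lebesgue A < \<infinity> \<and> 0 < c" for A :: "(real ^ 'n) set" and c
    using that const_in_sup_class F_p1_const assms(3) by blast
  \<comment> \<open>One concrete maximiser is enough for the lower bound on the supremum.\<close>
  have B: "(?B, \<lambda>x. 1) \<in> sup_class \<and> F_p1 p ?B (\<lambda>x. 1) = gamma_p p"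
    by (intro const conjI emeasure_lebesgue_ball_finite) auto
  have cone: "(?B, \<lambda>x. 1 - norm x) \<in> inf_class" "F_p1 p ?B (\<lambda>x. 1 - norm x) = ?m"
    using cone_in_inf_class F_p1_cone[OF assms(3), where 'a="real ^ 'n"] m by auto
  have "(SUP (A, h) \<in> (sup_class :: ((real ^ 'n) set \<times> (real ^ 'n \<Rightarrow> real)) set).
            ereal (F_p1 p A h)) = ereal (gamma_p p)"
  proof (rule antisym)
    show "ereal (gamma_p p) \<le> (SUP (A, h) \<in> (sup_class :: ((real ^ 'n) set \<times> (real ^ 'n \<Rightarrow> real)) set).
            ereal (F_p1 p A h))"
      using B by (intro SUP_upper2[of "(?B, \<lambda>x. 1)"]) auto
  qed (auto intro!: SUP_least F_p1_le_gamma_p assms(3) simp: sup_class_def)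
  moreover have "(INF (A, h) \<in> (inf_class :: ((real ^ 'n) set \<times> (real ^ 'n \<Rightarrow> real)) set).
            ereal (F_p1 p A h)) = ereal ?m"
  proof (rule antisym)
    show "(INF (A, h) \<in> (inf_class :: ((real ^ 'n) set \<times> (real ^ 'n \<Rightarrow> real)) set).
            ereal (F_p1 p A h)) \<le> ereal ?m"
      using cone by (intro INF_lower2[of "(?B, \<lambda>x. 1 - norm x)"]) auto
  qed (use F_p1_ge_moment_ratio[OF assms(3)] m in \<open>force intro!: INF_greatest\<close>)
  ultimately show ?thesis
    using const cone by blast
qed

end
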